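(* Given query access to $f:[n]^d\to\{0,1\}$, one can simulate query access to a function $g:[N]^d\to\{0,1\}$ with the following properties: (1) $N$ is a power of $2$ and $N=\Theta(nd)$; (2) if $f$ is monotone then so is $g$, and if $f$ is $\varepsilon$-far from monotone then $g$ is $\varepsilon/6$-far from monotone; (3) a single query to $g$ can be simulated by a single query to $f$.
   Context: $[m]^d$ is partially ordered coordinatewise; a function $h:[m]^d\to\{0,1\}$ is monotone if $h(x)\le h(y)$ whenever $x\preceq y$, and is $\delta$-far from monotone if it differs from every monotone function on at least a $\delta$ fraction of $[m]^d$. *)

theory Defs
  imports Complex_Main "HOL-Library.FuncSet"
begin

text \<open>
  The poset \<open>[m]\<^sup>d\<close>. Points are extensional functions, all \<open>undefined\<close> outside \<open>{..<d}\<close>, so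
  the pointwise order on \<^typ>\<open>nat \<Rightarrow> nat\<close> restricts to the coordinatewise order on the grid.
  A function \<open>[m]\<^sup>d \<rightarrow> {0,1}\<close> is rendered as \<open>h :: (nat \<Rightarrow> nat) \<Rightarrow> bool\<close>, of which only the values
  on \<open>grid m d\<close> matter; it is monotone if \<open>mono_on (grid m d) h\<close>, where \<open>False < True\<close>.
\<close>

definition grid :: "nat \<Rightarrow> nat \<Rightarrow> (nat \<Rightarrow> nat) set" where
  "grid m d = {..<d} \<rightarrow>\<^sub>E {1..m}"

definition far_from_monotone :: "nat \<Rightarrow> nat \<Rightarrow> real \<Rightarrow> ((nat \<Rightarrow> nat) \<Rightarrow> bool) \<Rightarrow> bool" where
  "far_from_monotone m d \<delta> h \<longleftrightarrow>
     (\<forall>k. mono_on (grid m d) k \<longrightarrow>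
        real (card {x \<in> grid m d. h x \<noteq> k x}) \<ge> \<delta> * real (card (grid m d)))"

text \<open>
  Deterministic, adaptive computations of one bit that access a Boolean function only through
  queries (decision trees). Such a computation is fixed before the queried function is.
\<close>

datatype 'q query_comp = Return bool | Query 'q "bool \<Rightarrow> 'q query_comp"

primrec result :: "('q \<Rightarrow> bool) \<Rightarrow> 'q query_comp \<Rightarrow> bool" where
  "result f (Return b) = b"
| "result f (Query q c) = result f (c (f q))"

primrec queries :: "('q \<Rightarrow> bool) \<Rightarrow> 'q query_comp \<Rightarrow> 'q list" where
  "queries f (Return b) = []"
| "queries f (Query q c) = q # queries f (c (f q))"

end

theory Submission imports Defs begin

text \<open>
  Cut \<open>[N]\<close> into \<open>n\<close> consecutive blocks, each of length at least \<open>s = \<lfloor>N/n\<rfloor>\<close>, and let \<open>g\<close> be \<open>f\<close>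
  evaluated at the tuple of block indices. Picking the element at a fixed offset in each block, one
  offset \<open>z \<in> [s]\<^sup>d\<close> for all blocks, embeds \<open>[n]\<^sup>d\<close> monotonically in \<open>[N]\<^sup>d\<close>, and \<open>g\<close> restricts to \<open>f\<close> on
  the image. The \<open>s\<^sup>d\<close> images are disjoint, so if \<open>f\<close> is \<open>\<epsilon>\<close>-far from monotone, then \<open>g\<close> disagrees with
  every monotone function in at least \<open>\<epsilon>(ns)\<^sup>d\<close> points. If \<open>N \<ge> 2nd\<close>, then \<open>ns \<ge> N - n \<ge> (1 - 1/(2d))N\<close>,
  whence \<open>(ns)\<^sup>d \<ge> N\<^sup>d/2\<close> by Bernoulli's inequality.
\<close>

text \<open>Capping at \<open>n\<close> makes the last block absorb whatever lies beyond
  \<open>n * s\<close>, so \<open>N\<close> need not be a multiple of \<open>n\<close>.\<close>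

definition block_index :: "nat \<Rightarrow> nat \<Rightarrow> nat \<Rightarrow> nat" where
  "block_index n s i = min n (Suc ((i - 1) div s))"

definition block_elem :: "nat \<Rightarrow> nat \<Rightarrow> nat \<Rightarrow> nat" where
  "block_elem s i j = (i - 1) * s + j"

definition coarsen :: "nat \<Rightarrow> nat \<Rightarrow> nat \<Rightarrow> (nat \<Rightarrow> nat) \<Rightarrow> nat \<Rightarrow> nat" where
  "coarsen n s d y = (\<lambda>i\<in>{..<d}. block_index n s (y i))"

definition refine :: "nat \<Rightarrow> nat \<Rightarrow> (nat \<Rightarrow> nat) \<Rightarrow> (nat \<Rightarrow> nat) \<Rightarrow> nat \<Rightarrow> nat" where
  "refine s d z x = (\<lambda>i\<in>{..<d}. block_elem s (x i) (z i))"

lemma block_index_mono: "i \<le> j \<Longrightarrow> block_index n s i \<le> block_index n s j"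
  unfolding block_index_def by (intro min.mono) (auto intro!: div_le_mono diff_le_mono)

lemma block_index_mem: "1 \<le> n \<Longrightarrow> block_index n s i \<in> {1..n}"
  by (auto simp: block_index_def)

lemma block_index_block_elem:
  assumes "i \<in> {1..n}" "j \<in> {1..s}"
  shows "block_index n s (block_elem s i j) = i"
proof -
  \<comment> \<open>Subtracting 1 turns the 1-based offset into a genuine remainder
    \<open>j - 1 < s\<close>, with quotient \<open>i - 1\<close>.\<close>
  have "(i - 1) * s + j - 1 = (j - 1) + (i - 1) * s" and "j - 1 < s" using assms by auto
  then have "((i - 1) * s + j - 1) div s = i - 1" by simp
  then show ?thesis using assms by (auto simp: block_index_def block_elem_def)
qed

lemma block_elem_mem:
  assumes "i \<in> {1..n}" "j \<in> {1..s}" "n * s \<le> N"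
  shows "block_elem s i j \<in> {1..N}"
proof -
  have "(i - 1) * s + j \<le> (i - 1) * s + s" using assms by simp
  also have "\<dots> = i * s" using assms by (cases i) auto
  also have "\<dots> \<le> n * s" using assms by simp
  finally show ?thesis using assms by (simp add: block_elem_def)
qed

lemma grid_memD: "x \<in> grid m d \<Longrightarrow> i < d \<Longrightarrow> x i \<in> {1..m}"
  unfolding grid_def by (drule PiE_mem[of _ _ _ i]) simp_all

lemma finite_grid: "finite (grid m d)"
  by (simp add: grid_def finite_PiE)

lemma card_grid: "card (grid m d) = m ^ d"
  by (simp add: grid_def card_PiE)

lemma coarsen_mem_grid: "1 \<le> n \<Longrightarrow> coarsen n s d y \<in> grid n d"
  using block_index_mem by (auto simp: coarsen_def grid_def)

lemma coarsen_mono: "x \<le> y \<Longrightarrow> coarsen n s d x \<le> coarsen n s d y"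
  by (auto simp: coarsen_def le_fun_def restrict_def intro: block_index_mono)

lemma refine_mem_grid:
  assumes "x \<in> grid n d" "z \<in> grid s d" "n * s \<le> N"
  shows "refine s d z x \<in> grid N d"
  using block_elem_mem[OF grid_memD[OF assms(1)] grid_memD[OF assms(2)] assms(3)]
  by (auto simp: refine_def grid_def)

lemma refine_mono: "x \<le> y \<Longrightarrow> refine s d z x \<le> refine s d z y"
  by (auto simp: refine_def block_elem_def le_fun_def restrict_def intro!: mult_le_mono1 diff_le_mono)

lemma coarsen_refine:
  assumes "x \<in> grid n d" "z \<in> grid s d"
  shows "coarsen n s d (refine s d z x) = x"
proof
  fix i
  show "coarsen n s d (refine s d z x) i = x i"
  proof (cases "i < d")
    case True
    then show ?thesis
      using block_index_block_elem[OF grid_memD[OF assms(1)] grid_memD[OF assms(2)]]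
      by (simp add: coarsen_def refine_def)
  next
    case False
    \<comment> \<open>Outside the \<open>d\<close> coordinates both sides are
      \<open>undefined\<close>, as \<open>x\<close> is extensional.\<close>
    then show ?thesis using assms(1) by (auto simp: coarsen_def grid_def PiE_def extensional_def)
  qed
qed

text \<open>Coarsening recovers \<open>x\<close>; cancelling the common block start
  \<open>(x i - 1) * s\<close> then recovers each offset \<open>z i\<close>.\<close>

lemma inj_on_refine: "inj_on (\<lambda>(z, x). refine s d z x) (grid s d \<times> grid n d)"
proof (rule inj_onI, clarify)
  fix z x z' x'
  assume mem: "z \<in> grid s d" "x \<in> grid n d" "z' \<in> grid s d" "x' \<in> grid n d"
    and eq: "refine s d z x = refine s d z' x'"
  have "x = x'" using mem eq coarsen_refine by metis
  moreover have "z i = z' i" if "i < d" for i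
    using fun_cong[OF eq, of i] that \<open>x = x'\<close> by (simp add: refine_def block_elem_def)
  then have "z = z'" using mem by (intro PiE_ext) (auto simp: grid_def)
  ultimately show "z = z' \<and> x = x'" by simp
qed

lemma far_from_monotone_coarsen:
  assumes far: "far_from_monotone n d \<epsilon> f" and le: "n * s \<le> N"
    and \<delta>: "\<delta> * real N ^ d \<le> \<epsilon> * real (n * s) ^ d"
  shows "far_from_monotone N d \<delta> (\<lambda>y. f (coarsen n s d y))"
  unfolding far_from_monotone_def
proof (intro allI impI)
  fix k :: "(nat \<Rightarrow> nat) \<Rightarrow> bool" assume k: "mono_on (grid N d) k"
  let ?B = "{y \<in> grid N d. f (coarsen n s d y) \<noteq> k y}"
  let ?A = "\<lambda>z. {x \<in> grid n d. f x \<noteq> k (refine s d z x)}"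
  \<comment> \<open>For a fixed offset \<open>z\<close>, pulling \<open>k\<close> back along the
    embedding gives a monotone competitor on the small grid, to which farness of \<open>f\<close>
    applies.\<close>
  have A: "\<epsilon> * real (n ^ d) \<le> real (card (?A z))" if z: "z \<in> grid s d" for z
  proof -
    have "mono_on (grid n d) (\<lambda>x. k (refine s d z x))"
    proof (rule mono_onI)
      fix x y assume "x \<in> grid n d" "y \<in> grid n d" "x \<le> y"
      then show "k (refine s d z x) \<le> k (refine s d z y)"
        by (intro mono_onD[OF k] refine_mono refine_mem_grid[OF _ z le])
    qed
    then show ?thesis using far by (simp add: far_from_monotone_def card_grid)
  qed
  \<comment> \<open>On embedded points the coarsened function takes the value \<open>f x\<close>, so
    every disagreement with the pullback is a disagreement with \<open>k\<close>.\<close>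
  have sub: "(\<lambda>(z, x). refine s d z x) ` Sigma (grid s d) ?A \<subseteq> ?B"
    using refine_mem_grid[OF _ _ le] coarsen_refine by auto
  have "inj_on (\<lambda>(z, x). refine s d z x) (Sigma (grid s d) ?A)"
    by (rule inj_on_subset[OF inj_on_refine]) auto
  then have card: "card (Sigma (grid s d) ?A) \<le> card ?B"
    using card_mono[OF _ sub] by (simp add: card_image finite_grid)
  \<comment> \<open>There are \<open>s ^ d\<close> offsets, so the sum equals \<epsilon> times
    \<open>(n * s) ^ d\<close>.\<close>
  have "\<delta> * real (card (grid N d)) \<le> (\<Sum>z\<in>grid s d. \<epsilon> * real (n ^ d))"
    using \<delta> by (simp add: card_grid power_mult_distrib mult_ac)
  also have "\<dots> \<le> (\<Sum>z\<in>grid s d. real (card (?A z)))"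
    by (intro sum_mono A)
  also have "\<dots> = real (card (Sigma (grid s d) ?A))"
    by (simp add: card_SigmaI finite_grid)
  also have "\<dots> \<le> real (card ?B)" using card by simp
  finally show "\<delta> * real (card (grid N d)) \<le> real (card ?B)" .
qed

lemma half_power_le_blocks_power:
  fixes n d N :: nat
  assumes "1 \<le> n" "1 \<le> d" "2 * (n * d) \<le> N"
  shows "real N ^ d / 2 \<le> real (n * (N div n)) ^ d"
proof -
  have "real N \<le> real (n * (N div n)) + real n"
  proof -
    have "n * (N div n) + N mod n = N" "N mod n < n" using assms(1) by auto
    then have "N \<le> n * (N div n) + n" by linarith
    then show ?thesis unfolding of_nat_add[symmetric] of_nat_le_iff .
  qed
  moreover have "real n \<le> real N / (2 * real d)"
  proof -
    have "real (2 * (n * d)) \<le> real N" using assms(3) of_nat_le_iff by blast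
    then show ?thesis using assms(2) by (simp add: field_simps)
  qed
  ultimately have block: "real N * (1 + - 1 / (2 * real d)) \<le> real (n * (N div n))"
    by (simp add: algebra_simps)
  \<comment> \<open>Bernoulli is applied at \<open>- 1 / (2 * real d)\<close>, which makes the
    linear bound exactly 1/2.\<close>
  have "1 / 2 = 1 + real d * (- 1 / (2 * real d))" using assms(2) by simp
  also have "\<dots> \<le> (1 + - 1 / (2 * real d)) ^ d"
    using assms(2) by (intro Bernoulli_inequality) (simp add: field_simps)
  finally have "real N ^ d * (1 / 2) \<le> real N ^ d * (1 + - 1 / (2 * real d)) ^ d"
    by (intro mult_left_mono) auto
  also have "\<dots> = (real N * (1 + - 1 / (2 * real d))) ^ d" by (simp only: power_mult_distrib)
  also have "\<dots> \<le> real (n * (N div n)) ^ d"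
    using assms(2) by (intro power_mono block mult_nonneg_nonneg) (auto simp: field_simps)
  finally show ?thesis by simp
qed

lemma ex_power_of_2_between:
  fixes m :: nat
  assumes "1 \<le> m"
  obtains k :: nat where "m \<le> 2 ^ k" "2 ^ k \<le> 2 * m"
proof -
  obtain k where "2 ^ k \<le> m" "m < 2 ^ (k + 1)"
    using ex_power_ivl1[of 2 m] assms by auto
  \<comment> \<open>With \<open>2 ^ k\<close> the largest power of 2 not exceeding \<open>m\<close>,
    the next power is above \<open>m\<close> and at most \<open>2 * m\<close>.\<close>
  then show ?thesis by (intro that[of "k + 1"]) auto
qed

theorem theoremA1:
  "\<exists>c C :: real. 0 < c \<and> 0 < C \<and>
     (\<forall>n d :: nat. 1 \<le> n \<longrightarrow> 1 \<le> d \<longrightarrow>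
       (\<exists>N :: nat.
          (\<exists>k :: nat. N = 2 ^ k) \<and>
          c * real (n * d) \<le> real N \<and> real N \<le> C * real (n * d) \<and>
          (\<exists>S :: (nat \<Rightarrow> nat) \<Rightarrow> (nat \<Rightarrow> nat) query_comp.
             \<forall>f :: (nat \<Rightarrow> nat) \<Rightarrow> bool. \<exists>g :: (nat \<Rightarrow> nat) \<Rightarrow> bool.
               (\<forall>y \<in> grid N d.
                  result f (S y) = g y \<and>
                  set (queries f (S y)) \<subseteq> grid n d \<and>
                  length (queries f (S y)) = 1) \<and>
               (mono_on (grid n d) f \<longrightarrow> mono_on (grid N d) g) \<and>
               (\<forall>\<epsilon> :: real. 0 < \<epsilon> \<longrightarrow>
                  far_from_monotone n d \<epsilon> f \<longrightarrow> far_from_monotone N d (\<epsilon> / 6) g))))"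
\<comment> \<open>The lower constant 2 is what the Bernoulli estimate requires; rounding up to a
  power of 2 at most doubles it, giving 4.\<close>
proof (rule exI[of _ 2], rule exI[of _ 4], intro conjI allI impI)
  fix n d :: nat
  assume n: "1 \<le> n" and d: "1 \<le> d"
  obtain k :: nat where k: "2 * (n * d) \<le> 2 ^ k" "2 ^ k \<le> 2 * (2 * (n * d))"
    using ex_power_of_2_between[of "2 * (n * d)"] n d by auto
  define N :: nat where "N = 2 ^ k"
  define s where "s = N div n"
  \<comment> \<open>The query point depends on \<open>y\<close> alone, so \<open>S\<close> is fixed
    before \<open>f\<close>; the answer is returned unchanged.\<close>
  define S where "S y = Query (coarsen n s d y) Return" for y
  have lo: "2 * (n * d) \<le> N" and hi: "N \<le> 4 * (n * d)" using k by (auto simp: N_def)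
  have lo': "2 * real (n * d) \<le> real N" and hi': "real N \<le> 4 * real (n * d)"
    using lo hi by linarith+
  have le: "n * s \<le> N" by (simp add: s_def)
  have "\<exists>g. (\<forall>y \<in> grid N d. result f (S y) = g y \<and> set (queries f (S y)) \<subseteq> grid n d \<and>
                  length (queries f (S y)) = 1) \<and>
            (mono_on (grid n d) f \<longrightarrow> mono_on (grid N d) g) \<and>
            (\<forall>\<epsilon> :: real. 0 < \<epsilon> \<longrightarrow>
                  far_from_monotone n d \<epsilon> f \<longrightarrow> far_from_monotone N d (\<epsilon> / 6) g)" for f
  proof (intro exI conjI ballI allI impI)
    fix y assume "y \<in> grid N d"
    show "result f (S y) = f (coarsen n s d y)" by (simp add: S_def)
    show "set (queries f (S y)) \<subseteq> grid n d" using coarsen_mem_grid[OF n] by (simp add: S_def)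
    show "length (queries f (S y)) = 1" by (simp add: S_def)
  next
    assume "mono_on (grid n d) f"
    then show "mono_on (grid N d) (\<lambda>y. f (coarsen n s d y))"
      by (intro mono_onI) (erule mono_onD, auto intro: coarsen_mem_grid coarsen_mono n)
  next
    fix \<epsilon> :: real
    assume \<epsilon>: "0 < \<epsilon>" and far: "far_from_monotone n d \<epsilon> f"
    \<comment> \<open>The construction in fact preserves \<epsilon>/2, so \<epsilon>/6 leaves
      slack.\<close>
    have "\<epsilon> / 6 * real N ^ d \<le> \<epsilon> * (real N ^ d / 2)" using \<epsilon> by simp
    also have "\<dots> \<le> \<epsilon> * real (n * s) ^ d"
      using \<epsilon> half_power_le_blocks_power[OF n d lo] by (intro mult_left_mono) (auto simp: s_def)
    finally show "far_from_monotone N d (\<epsilon> / 6) (\<lambda>y. f (coarsen n s d y))"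
      by (rule far_from_monotone_coarsen[OF far le])
  qed
  then show "\<exists>N :: nat.
          (\<exists>k :: nat. N = 2 ^ k) \<and>
          2 * real (n * d) \<le> real N \<and> real N \<le> 4 * real (n * d) \<and>
          (\<exists>S :: (nat \<Rightarrow> nat) \<Rightarrow> (nat \<Rightarrow> nat) query_comp.
             \<forall>f :: (nat \<Rightarrow> nat) \<Rightarrow> bool. \<exists>g :: (nat \<Rightarrow> nat) \<Rightarrow> bool.
               (\<forall>y \<in> grid N d.
                  result f (S y) = g y \<and>
                  set (queries f (S y)) \<subseteq> grid n d \<and>
                  length (queries f (S y)) = 1) \<and>
               (mono_on (grid n d) f \<longrightarrow> mono_on (grid N d) g) \<and>
               (\<forall>\<epsilon> :: real. 0 < \<epsilon> \<longrightarrow>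
                  far_from_monotone n d \<epsilon> f \<longrightarrow> far_from_monotone N d (\<epsilon> / 6) g))"
    using lo' hi' N_def by (intro exI[of _ N] conjI exI[of _ S] allI exI[of _ k])
qed simp_all

end
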